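(* Let $1<a<\tfrac32$ and let $V$ satisfy the assumptions in the context for this $a$. Then the functional $E_\infty^1$ defined in the context is not bounded from below on $\operatorname{Dom}E_\infty^1$; in fact there exists $(\epsilon,\eta)\in\operatorname{Dom}E_\infty^1$ with $E_\infty^1(\epsilon,\eta)=-\infty$.
   Context: $\mathbb{N}=\{1,2,3,\dots\}$ and $\ell^2(\mathbb{N})$ is the space of real square-summable sequences. **Assumptions on the potential.** $V:\mathbb{R}\to[0,+\infty]$ satisfies: - $V:\mathbb{R}\setminus\{0\}\to(0,+\infty)$ is even and $C^2$; - $V(x)\to V(0)=+\infty$ as $x\downarrow0$ or $x\uparrow 0$; - for each $x\in(0,+\infty)$ there exists $\lambda(x)>0$ such that $\inf_{(0,x)}V''\ge\lambda(x)$; - $V(x),V'(x)\to0$ as $|x|\to\infty$, and there are constants $0<c\le C$ and $x_0>0$ such that $c\,x^{-a-2}\le V''(x)\le C\,x^{-a-2}$ for all $x\ge x_0$. **The functional.** For $k\ge1$ let $\phi_k(y):=V(k+y)-V(k)-V'(k)y$ (with value $+\infty$ at $y=-k$); $\phi_k\ge0$ on $[-k,\infty)$. Let $\sigma^\infty(i):=\sum_{k=i+1}^\infty(k-i)|V'(k)|$ for $i\ge1$ (finite since $a>1$). Set $$\operatorname{Dom}E_\infty^1:=\big\{(\epsilon,\eta)\in\ell^2(\mathbb{N})\times\ell^2(\mathbb{N}):\epsilon(i)\ge-1,\ \eta(i)\ge-1\ \ \forall i\ge1\big\},$$ $$E_\infty^1(\epsilon,\eta):=\sum_{k=1}^\infty\sum_{j=0}^\infty\phi_k\Big(\sum_{l=j+1}^{k+j}\epsilon(l)\Big)+\sum_{k=1}^\infty\sum_{j=0}^\infty\phi_k\Big(\sum_{l=j+1}^{k+j}\eta(l)\Big)+\sum_{i=1}^\infty\sigma^\infty(i)\big(\epsilon(i)+\eta(i)\big),$$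 where the last series takes a value in $[-\infty,0]$ when $\epsilon,\eta\le0$, and $E_\infty^1(\epsilon,\eta)=-\infty$ means that the two double sums are finite and the last series equals $-\infty$. *)

theory Defs
  imports "HOL-Analysis.Analysis"
begin

definition pot_real :: "(real \<Rightarrow> ereal) \<Rightarrow> real \<Rightarrow> real" where
  "pot_real V x = real_of_ereal (V x)"

definition pot_deriv :: "(real \<Rightarrow> ereal) \<Rightarrow> real \<Rightarrow> real" where
  "pot_deriv V = deriv (pot_real V)"

definition pot_deriv2 :: "(real \<Rightarrow> ereal) \<Rightarrow> real \<Rightarrow> real" where
  "pot_deriv2 V = deriv (pot_deriv V)"

definition potential :: "real \<Rightarrow> (real \<Rightarrow> ereal) \<Rightarrow> bool" where
  "potential a V \<longleftrightarrow>
     (\<forall>x. x \<noteq> 0 \<longrightarrow> 0 < V x \<and> V x < \<infinity>) \<and>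
     (\<forall>x. V (- x) = V x) \<and>
     pot_real V differentiable_on (- {0}) \<and>
     pot_deriv V differentiable_on (- {0}) \<and>
     continuous_on (- {0}) (pot_deriv2 V) \<and>
     V 0 = \<infinity> \<and> (V \<longlongrightarrow> \<infinity>) (at_right 0) \<and> (V \<longlongrightarrow> \<infinity>) (at_left 0) \<and>
     (\<forall>x>0. \<exists>lam>0. \<forall>y\<in>{0<..<x}. lam \<le> pot_deriv2 V y) \<and>
     (V \<longlongrightarrow> 0) at_infinity \<and> (pot_deriv V \<longlongrightarrow> 0) at_infinity \<and>
     (\<exists>c C x0. 0 < c \<and> c \<le> C \<and> 0 < x0 \<and>
        (\<forall>x\<ge>x0. c * x powr (- a - 2) \<le> pot_deriv2 V x \<and>
                 pot_deriv2 V x \<le> C * x powr (- a - 2)))"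

(* Sequences indexed by {1, 2, 3, ...} are functions on nat whose value at 0 is
   never used. *)

definition ell2 :: "(nat \<Rightarrow> real) set" where
  "ell2 = {u. (\<lambda>i. (u i)\<^sup>2) summable_on {1..}}"

definition phi :: "(real \<Rightarrow> ereal) \<Rightarrow> nat \<Rightarrow> real \<Rightarrow> ereal" where
  "phi V k y = V (real k + y) - V (real k) - ereal (pot_deriv V (real k) * y)"

definition sigma_inf :: "(real \<Rightarrow> ereal) \<Rightarrow> nat \<Rightarrow> real" where
  "sigma_inf V i = (\<Sum>\<^sub>\<infinity>k\<in>{i+1..}. (real k - real i) * \<bar>pot_deriv V (real k)\<bar>)"

definition Dom_E1 :: "((nat \<Rightarrow> real) \<times> (nat \<Rightarrow> real)) set" where
  "Dom_E1 = {(eps, eta) \<in> ell2 \<times> ell2. \<forall>i\<ge>1. eps i \<ge> - 1 \<and> eta i \<ge> - 1}"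

(* On the domain all terms are nonnegative; the outer index k starts at 1. *)

definition interaction :: "(real \<Rightarrow> ereal) \<Rightarrow> (nat \<Rightarrow> real) \<Rightarrow> ereal" where
  "interaction V u = (\<Sum>k. \<Sum>j. phi V (Suc k) (\<Sum>l=j+1..Suc k + j. u l))"

(* The upper limit of the partial sums is the value of the series whenever the
   series has one in the extended reals, in particular when eps, eta \<le> 0; it equals
   -\<infinity> only if the partial sums tend to -\<infinity>. *)

definition linear_term :: "(real \<Rightarrow> ereal) \<Rightarrow> (nat \<Rightarrow> real) \<Rightarrow> (nat \<Rightarrow> real) \<Rightarrow> ereal" where
  "linear_term V eps eta =
     limsup (\<lambda>n. ereal (\<Sum>i=1..n. sigma_inf V i * (eps i + eta i)))"

(* Addition of extended reals satisfies \<infinity> + (-\<infinity>) = \<infinity>, so the energy can only be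
   -\<infinity> if both interaction sums are finite; see E1_eq_MInf_iff. *)

definition E1 :: "(real \<Rightarrow> ereal) \<Rightarrow> (nat \<Rightarrow> real) \<times> (nat \<Rightarrow> real) \<Rightarrow> ereal" where
  "E1 V = (\<lambda>(eps, eta). interaction V eps + interaction V eta + linear_term V eps eta)"

lemma linear_term_eq:
  assumes "(\<lambda>n. ereal (\<Sum>i=1..n. sigma_inf V i * (eps i + eta i))) \<longlonglongrightarrow> L"
  shows "linear_term V eps eta = L"
  unfolding linear_term_def using assms by (intro lim_imp_Limsup) auto

lemma linear_term_eq_MInf_iff:
  "linear_term V eps eta = -\<infinity> \<longleftrightarrow>
     (\<lambda>n. ereal (\<Sum>i=1..n. sigma_inf V i * (eps i + eta i))) \<longlonglongrightarrow> -\<infinity>"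
  unfolding linear_term_def by (rule Limsup_MInfty[symmetric]) simp

lemma E1_eq_MInf_iff:
  assumes "interaction V eps \<ge> 0" "interaction V eta \<ge> 0"
  shows "E1 V (eps, eta) = -\<infinity> \<longleftrightarrow>
     interaction V eps < \<infinity> \<and> interaction V eta < \<infinity> \<and> linear_term V eps eta = -\<infinity>"
  using assms unfolding E1_def by (auto simp: ereal_plus_eq_MInfty)

end

theory Submission
  imports Defs
begin

text \<open>The interaction is finite on every square-summable sequence bounded below by -1/2: Taylor's
  formula gives phi_k(y) \<le> B k^(-a-2) y^2, Cauchy-Schwarz bounds the sum over j of the squared
  window sums of length k by k^2 times the squared l2-norm, and the sum of k^(-a) converges since
  a > 1. On the other hand integrating V'' twice shows that sigma(i) is at least of order i^(1-a).
  The sequence -i^(a-2)/2 is square-summable exactly because a < 3/2, and against sigma it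
  produces the divergent harmonic series.\<close>

section \<open>Regularity and convexity of V away from the origin\<close>

lemma potential_eq_ereal:
  assumes "potential a V" "x \<noteq> 0"
  shows "V x = ereal (pot_real V x)"
proof -
  have "0 < V x" "V x < \<infinity>"
    using assms unfolding potential_def by auto
  then show ?thesis
    unfolding pot_real_def by (cases "V x") auto
qed

lemma pot_real_has_deriv:
  assumes "potential a V" "x \<noteq> 0"
  shows "(pot_real V has_real_derivative pot_deriv V x) (at x)"
proof -
  have "pot_real V differentiable (at x within - {0})"
    using assms unfolding potential_def differentiable_on_def by auto
  moreover have "at x within - {0} = at x"
    using assms by (intro at_within_open) auto
  ultimately show ?thesis
    by (simp add: pot_deriv_def DERIV_deriv_iff_real_differentiable)
qed

lemma pot_deriv_has_deriv:
  assumes "potential a V" "x \<noteq> 0"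
  shows "(pot_deriv V has_real_derivative pot_deriv2 V x) (at x)"
proof -
  have "pot_deriv V differentiable (at x within - {0})"
    using assms unfolding potential_def differentiable_on_def by auto
  moreover have "at x within - {0} = at x"
    using assms by (intro at_within_open) auto
  ultimately show ?thesis
    by (simp add: pot_deriv2_def DERIV_deriv_iff_real_differentiable)
qed

lemma pot_deriv2_pos:
  assumes "potential a V" "x > 0"
  shows "pot_deriv2 V x > 0"
proof -
  \<comment> \<open>Convexity is assumed on open intervals (0, r); taking r = 2x puts x
    inside.\<close>
  obtain lam where "lam > 0" "\<forall>y\<in>{0<..<2*x}. lam \<le> pot_deriv2 V y"
    using assms unfolding potential_def by (elim conjE allE[where x = "2 * x"]) auto
  then have "lam \<le> pot_deriv2 V x" using assms by auto
  with \<open>lam > 0\<close> show ?thesis by simp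
qed

text \<open>The decay hypothesis covers only large x; on the compact rest, continuity bounds V''(x)
  x^(a+2). The threshold 1/2 fits the later Taylor points, which satisfy t \<ge> k/2 \<ge>
  1/2.\<close>

lemma pot_deriv2_upper:
  assumes "potential a V"
  shows "\<exists>B\<ge>0. \<forall>x\<ge>1/2. pot_deriv2 V x \<le> B * x powr (- a - 2)"
proof -
  obtain C x0 where C: "\<And>x. x \<ge> x0 \<Longrightarrow> pot_deriv2 V x \<le> C * x powr (- a - 2)"
    using assms unfolding potential_def by blast
  have "continuous_on {1/2..x0} (\<lambda>x. pot_deriv2 V x * x powr (a + 2))"
  proof (intro continuous_intros)
    show "continuous_on {1/2..x0} (pot_deriv2 V)"
      by (rule continuous_on_subset[of "- {0}"]) (use assms in \<open>auto simp: potential_def\<close>)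
  qed auto
  then have "bounded ((\<lambda>x. pot_deriv2 V x * x powr (a + 2)) ` {1/2..x0})"
    by (intro compact_imp_bounded compact_continuous_image) auto
  then obtain M where M: "\<And>x. x \<in> {1/2..x0} \<Longrightarrow> \<bar>pot_deriv2 V x * x powr (a + 2)\<bar> \<le> M"
    unfolding bounded_iff by (auto simp del: atLeastAtMost_iff)
  define B where "B = max 0 (max C M)"
  have "pot_deriv2 V x \<le> B * x powr (- a - 2)" if x: "x \<ge> 1/2" for x
  proof (cases "x \<ge> x0")
    case True
    have "C * x powr (- a - 2) \<le> B * x powr (- a - 2)"
      by (intro mult_right_mono) (auto simp: B_def)
    with C[OF True] show ?thesis by linarith
  next
    case False
    then have "pot_deriv2 V x * x powr (a + 2) \<le> B"
      using M[of x] x by (auto simp: B_def)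
    then have "pot_deriv2 V x * x powr (a + 2) * x powr (- a - 2) \<le> B * x powr (- a - 2)"
      by (intro mult_right_mono) auto
    moreover have "x powr (a + 2) * x powr (- a - 2) = 1"
      using x by (simp flip: powr_add)
    ultimately show ?thesis by (simp add: mult.assoc)
  qed
  then show ?thesis by (intro exI[of _ B]) (auto simp: B_def)
qed

section \<open>Decay of V' at infinity\<close>

text \<open>A nondecreasing function stays below its limit. This replaces integration of V'' over
  [x, \<infinity>) in the next lemma.\<close>

lemma nonpos_of_deriv_nonneg_tendsto_0:
  fixes g :: "real \<Rightarrow> real"
  assumes "\<And>x. x \<ge> x0 \<Longrightarrow> (g has_real_derivative g' x) (at x)"
    and "\<And>x. x \<ge> x0 \<Longrightarrow> g' x \<ge> 0"
    and "(g \<longlongrightarrow> 0) at_top" and "x \<ge> x0"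
  shows "g x \<le> 0"
proof (rule tendsto_lowerbound[OF assms(3)])
  show "\<forall>\<^sub>F y in at_top. g x \<le> g y"
    using eventually_ge_at_top[of x]
  proof eventually_elim
    case (elim y)
    have "\<exists>d. (g has_real_derivative d) (at z) \<and> d \<ge> 0" if "x \<le> z" for z
      using assms(1,2)[of z] assms(4) that by auto
    with elim show ?case by (intro DERIV_nonneg_imp_nondecreasing[of x y g]) auto
  qed
qed simp

text \<open>Each bound on V'' is integrated from x to infinity, using V' \<rightarrow> 0.
  Concretely, V' + c/(a+1) x^(-a-1) and -V' - C/(a+1) x^(-a-1) are nondecreasing and vanish at
  infinity, so both are nonpositive.\<close>

lemma pot_deriv_bounds:
  assumes "potential a V" "a > 1"
  shows "\<exists>c C x0. 0 < c \<and> 0 < x0 \<and> (\<forall>x\<ge>x0. c * x powr (- a - 1) \<le> \<bar>pot_deriv V x\<bar> \<and>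
            \<bar>pot_deriv V x\<bar> \<le> C * x powr (- a - 1))"
proof -
  obtain c C x0 where c: "0 < c" "c \<le> C" "0 < x0"
    and bd: "\<And>x. x \<ge> x0 \<Longrightarrow> c * x powr (- a - 2) \<le> pot_deriv2 V x"
            "\<And>x. x \<ge> x0 \<Longrightarrow> pot_deriv2 V x \<le> C * x powr (- a - 2)"
    using assms unfolding potential_def by blast
  have lim0: "(pot_deriv V \<longlongrightarrow> 0) at_top"
    using assms at_top_le_at_infinity tendsto_mono unfolding potential_def by blast
  have pw: "((\<lambda>x. K / (a + 1) * x powr (- a - 1)) has_real_derivative - (K * x powr (- a - 2))) (at x)"
    if "x > 0" for x K :: real
  proof (rule DERIV_cong)
    show "((\<lambda>x. K / (a + 1) * x powr (- a - 1)) has_real_derivative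
            K / (a + 1) * ((- a - 1) * x powr (- a - 1 - 1))) (at x)"
      using that by (intro DERIV_cmult has_real_derivative_powr)
    show "K / (a + 1) * ((- a - 1) * x powr (- a - 1 - 1)) = - (K * x powr (- a - 2))"
      using assms by (simp add: divide_simps) (simp add: algebra_simps minus_diff_commute)
  qed
  have pwlim: "((\<lambda>x. K / (a + 1) * x powr (- a - 1)) \<longlongrightarrow> 0) at_top" for K :: real
    using assms by (intro tendsto_mult_right_zero tendsto_neg_powr filterlim_ident) auto
  have lo: "pot_deriv V x + c / (a + 1) * x powr (- a - 1) \<le> 0" if "x \<ge> x0" for x
  proof (rule nonpos_of_deriv_nonneg_tendsto_0[OF _ _ _ that])
    show "((\<lambda>x. pot_deriv V x + c / (a + 1) * x powr (- a - 1))
            has_real_derivative pot_deriv2 V y + - (c * y powr (- a - 2))) (at y)" if "y \<ge> x0" for y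
      using that c by (intro DERIV_add pw pot_deriv_has_deriv[OF assms(1)]) auto
    show "((\<lambda>x. pot_deriv V x + c / (a + 1) * x powr (- a - 1)) \<longlongrightarrow> 0) at_top"
      using tendsto_add[OF lim0 pwlim] by simp
  qed (use bd in auto)
  have hi: "- pot_deriv V x - C / (a + 1) * x powr (- a - 1) \<le> 0" if "x \<ge> x0" for x
  proof (rule nonpos_of_deriv_nonneg_tendsto_0[OF _ _ _ that])
    show "((\<lambda>x. - pot_deriv V x - C / (a + 1) * x powr (- a - 1))
            has_real_derivative - pot_deriv2 V y - - (C * y powr (- a - 2))) (at y)" if "y \<ge> x0" for y
      using that c by (intro DERIV_diff DERIV_minus pw pot_deriv_has_deriv[OF assms(1)]) auto
    show "((\<lambda>x. - pot_deriv V x - C / (a + 1) * x powr (- a - 1)) \<longlongrightarrow> 0) at_top"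
      using tendsto_diff[OF tendsto_minus[OF lim0] pwlim] by simp
  qed (use bd in auto)
  show ?thesis
  proof (intro exI conjI allI impI)
    show "0 < c / (a + 1)" "0 < x0" using c assms by auto
    fix x assume x: "x \<ge> x0"
    \<comment> \<open>The lower estimate also fixes the sign V' \<le> 0, which turns both estimates
      into bounds on |V'|.\<close>
    have "0 \<le> c / (a + 1) * x powr (- a - 1)" using c assms by auto
    with lo[OF x] have "pot_deriv V x \<le> 0" by linarith
    then show "c / (a + 1) * x powr (- a - 1) \<le> \<bar>pot_deriv V x\<bar>"
      "\<bar>pot_deriv V x\<bar> \<le> C / (a + 1) * x powr (- a - 1)"
      using lo[OF x] hi[OF x] by linarith+
  qed
qed

section \<open>Finiteness of the interaction\<close>

text \<open>\<open>phi V k\<close> is the first-order Taylor remainder of V at k, hence V''(t) y^2 /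
  2 with t between k and k + y. The restriction on y keeps t \<ge> k/2, away from the singularity
  and in the range of the bound \<open>B\<close>, which is the same for all k.\<close>

lemma phi_bounds:
  assumes V: "potential a V" and a: "a > 1" and k: "k \<ge> 1" and y: "y \<ge> - real k / 2"
    and B: "B \<ge> 0" "\<And>x. x \<ge> 1/2 \<Longrightarrow> pot_deriv2 V x \<le> B * x powr (- a - 2)"
  shows "0 \<le> phi V k y"
    and "phi V k y \<le> ereal (B * (real k / 2) powr (- a - 2) * y\<^sup>2)"
proof -
  let ?W = "pot_real V"
  have phi: "phi V k y = ereal (?W (k + y) - ?W k - pot_deriv V k * y)"
    using k y by (simp add: phi_def potential_eq_ereal[OF V])
  have "\<exists>t\<ge>real k / 2. ?W (k + y) - ?W k - pot_deriv V k * y = pot_deriv2 V t / 2 * y\<^sup>2"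
  \<comment> \<open>\<open>Taylor\<close> needs two distinct points. For y = 0 the remainder
    vanishes and t = k serves.\<close>
  proof (cases "y = 0")
    case False
    define diff where "diff m = (if m = 0 then ?W else if m = 1 then pot_deriv V else pot_deriv2 V)"
      for m :: nat
    have "\<exists>t::real. (if k + y < real k then k + y < t \<and> t < k else k < t \<and> t < k + y) \<and>
       ?W (k + y) = (\<Sum>m<2. diff m k / fact m * (k + y - k) ^ m) + diff 2 t / fact 2 * (k + y - k)\<^sup>2"
    proof (rule Taylor[where a = "real k / 2" and b = "max (real k) (k + y)"])
      show "\<forall>m t. m < (2::nat) \<and> real k / 2 \<le> t \<and> t \<le> max (real k) (k + y) \<longrightarrow>
              (diff m has_real_derivative diff (Suc m) t) (at t)"
      proof (intro allI impI)
        fix m :: nat and t assume *: "m < 2 \<and> real k / 2 \<le> t \<and> t \<le> max (real k) (k + y)"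
        then have "t \<noteq> 0" using k by auto
        moreover from * have "m = 0 \<or> m = 1" by auto
        ultimately show "(diff m has_real_derivative diff (Suc m) t) (at t)"
          by (auto simp: diff_def pot_real_has_deriv[OF V] pot_deriv_has_deriv[OF V])
      qed
    qed (use False k y in \<open>auto simp: diff_def\<close>)
    then obtain t :: real where t: "if k + y < real k then k + y < t \<and> t < k else k < t \<and> t < k + y"
      and eq: "?W (k + y) = (\<Sum>m<2. diff m k / fact m * (k + y - k) ^ m) + diff 2 t / fact 2 * (k + y - k)\<^sup>2"
      by blast
    have "t \<ge> real k / 2" using t y k by (auto split: if_splits)
    moreover have "?W (k + y) - ?W k - pot_deriv V k * y = pot_deriv2 V t / 2 * y\<^sup>2"
      unfolding eq by (simp add: diff_def numeral_2_eq_2)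
    ultimately show ?thesis by blast
  qed (auto intro!: exI[of _ "real k"])
  then obtain t where t: "t \<ge> real k / 2"
    and eq: "?W (k + y) - ?W k - pot_deriv V k * y = pot_deriv2 V t / 2 * y\<^sup>2" by blast
  have pos: "pot_deriv2 V t > 0" using pot_deriv2_pos[OF V, of t] t k by linarith
  then show "0 \<le> phi V k y" unfolding phi eq by simp
  have "pot_deriv2 V t / 2 \<le> pot_deriv2 V t" using pos by simp
  also have "\<dots> \<le> B * t powr (- a - 2)" using t k by (intro B) auto
  also have "\<dots> \<le> B * (real k / 2) powr (- a - 2)"
    using B t k a by (intro mult_left_mono powr_mono2') auto
  finally show "phi V k y \<le> ereal (B * (real k / 2) powr (- a - 2) * y\<^sup>2)"
    unfolding phi eq ereal_less_eq by (rule mult_right_mono) simp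
qed

text \<open>Cauchy-Schwarz costs one factor k. After exchanging the sums, each of the k shifts of u
  contributes at most S, which gives the second factor k. The bound is uniform in n.\<close>

lemma sum_window_squares_le:
  fixes u :: "nat \<Rightarrow> real"
  assumes "\<And>N. (\<Sum>i=1..N. (u i)\<^sup>2) \<le> S"
  shows "(\<Sum>j<n. (\<Sum>l=j+1..k+j. u l)\<^sup>2) \<le> (real k)\<^sup>2 * S"
proof -
  have "(\<Sum>l=j+1..k+j. u l)\<^sup>2 \<le> real k * (\<Sum>i<k. (u (i + j + 1))\<^sup>2)" for j
  proof -
    have "(\<Sum>l=j+1..k+j. u l) = (\<Sum>i<k. u (i + j + 1))"
      by (rule sum.reindex_bij_witness[of _ "\<lambda>i. i + j + 1" "\<lambda>l. l - (j + 1)"]) auto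
    then show ?thesis
      using sum_squared_le_sum_of_squares[of "\<lambda>i. u (i + j + 1)" "{..<k}"] by (simp add: mult.commute)
  qed
  then have "(\<Sum>j<n. (\<Sum>l=j+1..k+j. u l)\<^sup>2) \<le> (\<Sum>j<n. real k * (\<Sum>i<k. (u (i + j + 1))\<^sup>2))"
    by (intro sum_mono)
  also have "\<dots> = real k * (\<Sum>i<k. \<Sum>j<n. (u (i + j + 1))\<^sup>2)"
    by (subst sum.swap) (simp add: sum_distrib_left)
  also have "\<dots> \<le> real k * (\<Sum>i<k. S)"
  proof (intro mult_left_mono sum_mono)
    fix i
    have "(\<Sum>j<n. (u (i + j + 1))\<^sup>2) = (\<Sum>l\<in>{i+1..<i+n+1}. (u l)\<^sup>2)"
      by (rule sum.reindex_bij_witness[of _ "\<lambda>l. l - (i + 1)" "\<lambda>j. i + j + 1"]) auto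
    also have "\<dots> \<le> (\<Sum>l=1..i+n+1. (u l)\<^sup>2)" by (intro sum_mono2) auto
    finally show "(\<Sum>j<n. (u (i + j + 1))\<^sup>2) \<le> S" using assms[of "i + n + 1"] by linarith
  qed simp
  finally show ?thesis by (simp add: power2_eq_square)
qed

lemma ell2_sums_le:
  assumes "u \<in> ell2"
  shows "(\<Sum>i=1..N. (u i)\<^sup>2) \<le> (\<Sum>\<^sub>\<infinity>i\<in>{1..}. (u i)\<^sup>2)"
  using assms unfolding ell2_def by (intro finite_sum_le_infsum) auto

text \<open>The lower bound -1/2, stricter than the -1 of the domain, makes every window sum of
  length k at least -k/2, as \<open>phi_bounds\<close> requires.\<close>

lemma interaction_finite:
  assumes V: "potential a V" and a: "a > 1" and u: "u \<in> ell2" "\<And>i. i \<ge> 1 \<Longrightarrow> u i \<ge> - 1/2"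
  shows "0 \<le> interaction V u" and "interaction V u < \<infinity>"
proof -
  obtain B where B: "B \<ge> 0" "\<And>x. x \<ge> 1/2 \<Longrightarrow> pot_deriv2 V x \<le> B * x powr (- a - 2)"
    using pot_deriv2_upper[OF V] by blast
  define S where "S = (\<Sum>\<^sub>\<infinity>i\<in>{1..}. (u i)\<^sup>2)"
  have S: "(\<Sum>i=1..N. (u i)\<^sup>2) \<le> S" for N
    unfolding S_def by (rule ell2_sums_le[OF u(1)])
  then have S0: "S \<ge> 0" using S[of 0] by simp
  \<comment> \<open>The index is shifted as in \<open>interaction\<close>: \<open>s k j\<close> is a
    window of length \<open>Suc k\<close>.\<close>
  define s where "s k j = (\<Sum>l=j+1..Suc k + j. u l)" for k j
  have s: "s k j \<ge> - real (Suc k) / 2" for k j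
  proof -
    have "(\<Sum>l=j+1..Suc k + j. - 1/2) \<le> s k j"
      unfolding s_def by (intro sum_mono u) auto
    then show ?thesis by (simp add: field_simps)
  qed
  define D where "D k = B * (real (Suc k) / 2) powr (- a - 2)" for k
  have D0: "D k \<ge> 0" for k using B by (simp add: D_def)
  have nn: "0 \<le> phi V (Suc k) (s k j)"
    and le: "phi V (Suc k) (s k j) \<le> ereal (D k * (s k j)\<^sup>2)" for k j
    unfolding D_def using phi_bounds[OF V a _ s B] by auto
  \<comment> \<open>The factor \<open>2 powr (a + 2)\<close> comes from the halved argument in
    \<open>D\<close>; the k^2 of the window estimate lifts the exponent -a-2 to -a, which is
    summable.\<close>
  define T where "T k = B * 2 powr (a + 2) * S * real (Suc k) powr (- a)" for k
  have T: "D k * ((real (Suc k))\<^sup>2 * S) = T k" for k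
  proof -
    have "(real (Suc k) / 2) powr (- a - 2) = real (Suc k) powr (- a - 2) * 2 powr (a + 2)"
      by (simp add: powr_divide powr_minus_divide powr_diff powr_add field_simps)
    moreover have "real (Suc k) powr (- a - 2) * (real (Suc k))\<^sup>2 = real (Suc k) powr (- a)"
      by (simp add: powr_diff powr_minus_divide field_simps del: of_nat_Suc)
    ultimately show ?thesis unfolding D_def T_def by (simp add: mult_ac del: of_nat_Suc)
  qed
  have inner: "(\<Sum>j. phi V (Suc k) (s k j)) \<le> ereal (T k)" for k
  proof (rule suminf_bound[OF _ nn], intro allI)
    fix n
    have "(\<Sum>j<n. phi V (Suc k) (s k j)) \<le> (\<Sum>j<n. ereal (D k * (s k j)\<^sup>2))"
      by (intro sum_mono le)
    also have "\<dots> = ereal (D k * (\<Sum>j<n. (s k j)\<^sup>2))"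
      by (simp add: sum_distrib_left)
    also have "\<dots> \<le> ereal (T k)"
      unfolding T[symmetric] s_def ereal_less_eq
      by (intro mult_left_mono sum_window_squares_le S D0)
    finally show "(\<Sum>j<n. phi V (Suc k) (s k j)) \<le> ereal (T k)" .
  qed
  have nn2: "0 \<le> (\<Sum>j. phi V (Suc k) (s k j))" for k
    by (intro suminf_nonneg summable_ereal_pos nn)
  have I: "interaction V u = (\<Sum>k. \<Sum>j. phi V (Suc k) (s k j))"
    by (simp add: interaction_def s_def)
  show "0 \<le> interaction V u"
    unfolding I by (intro suminf_nonneg summable_ereal_pos nn2)
  have sumT: "summable T"
  proof -
    have "summable (\<lambda>k. real k powr (- a))" using a by (simp add: summable_real_powr_iff)
    then have "summable (\<lambda>k. real (Suc k) powr (- a))" by (subst summable_Suc_iff)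
    then show ?thesis unfolding T_def by (intro summable_mult)
  qed
  have T0: "T k \<ge> 0" for k using B S0 by (simp add: T_def)
  have "interaction V u \<le> ereal (suminf T)" unfolding I
  proof (rule suminf_bound[OF _ nn2], intro allI)
    fix n
    have "(\<Sum>k<n. \<Sum>j. phi V (Suc k) (s k j)) \<le> (\<Sum>k<n. ereal (T k))"
      by (intro sum_mono inner)
    also have "\<dots> \<le> ereal (suminf T)"
      using sum_le_suminf[OF sumT, of "{..<n}"] T0 by simp
    finally show "(\<Sum>k<n. \<Sum>j. phi V (Suc k) (s k j)) \<le> ereal (suminf T)" .
  qed
  then show "interaction V u < \<infinity>" by (rule order_le_less_trans) simp
qed

section \<open>Growth of sigma and divergence of the linear term\<close>

lemma sigma_inf_nonneg: "sigma_inf V i \<ge> 0"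
  unfolding sigma_inf_def by (intro infsum_nonneg) auto

text \<open>It suffices to keep the i indices k in [2i, 3i): there k - i \<ge> i and |V'(k)| \<ge> c
  (3i)^(-a-1), so their sum is at least i * i * c (3i)^(-a-1).\<close>

lemma sigma_inf_lower:
  assumes V: "potential a V" and a: "a > 1"
  shows "\<exists>c N. 0 < c \<and> (\<forall>i>N. sigma_inf V i \<ge> c * real i powr (1 - a))"
proof -
  obtain c C x0 where c: "0 < c" "0 < x0"
    and lo: "\<And>x. x \<ge> x0 \<Longrightarrow> c * x powr (- a - 1) \<le> \<bar>pot_deriv V x\<bar>"
    and hi: "\<And>x. x \<ge> x0 \<Longrightarrow> \<bar>pot_deriv V x\<bar> \<le> C * x powr (- a - 1)"
    using pot_deriv_bounds[OF V a] by blast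
  define N where "N = nat \<lceil>x0\<rceil>"
  have N: "real k \<ge> x0" if "k \<ge> N" for k
    using that unfolding N_def by linarith
  have "sigma_inf V i \<ge> c * 3 powr (- a - 1) * real i powr (1 - a)" if i: "i > N" for i
  proof -
    let ?f = "\<lambda>k. (real k - real i) * \<bar>pot_deriv V (real k)\<bar>"
    have i0: "i \<ge> 1" using i by simp
    \<comment> \<open>Convergence must be checked first, since a divergent \<open>infsum\<close> has
      the default value 0. The upper bound on |V'| gives the majorant C k^(-a).\<close>
    have "summable (\<lambda>k. norm (?f k))"
    proof (rule summable_comparison_test_ev)
      show "summable (\<lambda>k. C * real k powr (- a))"
        using a by (intro summable_mult) (simp add: summable_real_powr_iff)
      show "\<forall>\<^sub>F k in sequentially. norm (norm (?f k)) \<le> C * real k powr (- a)"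
        using eventually_ge_at_top[of i]
      proof eventually_elim
        case (elim k)
        have k: "k \<ge> N" "k > 0" using elim i by auto
        have "norm (norm (?f k)) = (real k - real i) * \<bar>pot_deriv V (real k)\<bar>"
          using elim by (simp add: abs_mult)
        also have "\<dots> \<le> real k * (C * real k powr (- a - 1))"
          using elim hi[OF N[OF k(1)]] by (intro mult_mono) auto
        also have "\<dots> = C * real k powr (- a)"
          using k by (simp add: powr_diff)
        finally show ?case .
      qed
    qed
    then have sm: "?f summable_on {i+1..}"
      by (intro summable_on_subset_banach[OF norm_summable_imp_summable_on]) auto
    have "c * 3 powr (- a - 1) * real i powr (1 - a) =
        real i * (real i * (c * (3 * real i) powr (- a - 1)))"
      using i0 by (simp add: powr_mult powr_diff powr_minus_divide field_simps)
    also have "\<dots> \<le> (\<Sum>k\<in>{2*i..<3*i}. real i * (c * (3 * real i) powr (- a - 1)))"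
      by simp
    also have "\<dots> \<le> (\<Sum>k\<in>{2*i..<3*i}. ?f k)"
    proof (rule sum_mono)
      fix k assume k: "k \<in> {2*i..<3*i}"
      have "c * (3 * real i) powr (- a - 1) \<le> c * real k powr (- a - 1)"
        using k c a i0 by (intro mult_left_mono powr_mono2') auto
      also have "\<dots> \<le> \<bar>pot_deriv V k\<bar>" using k i by (intro lo N) auto
      finally show "real i * (c * (3 * real i) powr (- a - 1)) \<le> ?f k"
        using k c by (intro mult_mono) auto
    qed
    also have "\<dots> \<le> sigma_inf V i" unfolding sigma_inf_def
      by (rule finite_sum_le_infsum[OF sm]) (use i0 in auto)
    finally show ?thesis .
  qed
  moreover have "0 < c * 3 powr (- a - 1)" using c by simp
  ultimately show ?thesis by blast
qed

text \<open>The 1/2 in u cancels in u + u, so for large i the i-th term is at most -c i^(1-a)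
  i^(a-2) = -c/i.\<close>

lemma linear_term_diverges:
  assumes V: "potential a V" and a: "a > 1"
  defines "u \<equiv> \<lambda>i. - (real i powr (a - 2) / 2)"
  shows "linear_term V u u = - \<infinity>"
proof -
  obtain c N where c: "0 < c" and lo: "\<And>i. i > N \<Longrightarrow> sigma_inf V i \<ge> c * real i powr (1 - a)"
    using sigma_inf_lower[OF V a] by blast
  let ?P = "\<lambda>n. \<Sum>i=1..n. sigma_inf V i * (u i + u i)"
  have u: "u i + u i = - (real i powr (a - 2))" for i by (simp add: u_def)
  \<comment> \<open>The offset c \<open>harm N\<close> makes the right side 0 at n = N, where it
    suffices that the first N terms are nonpositive; each later term lowers the sum by at least
    c/n.\<close>
  have le: "?P n \<le> - c * harm n + c * harm N" if "n \<ge> N" for n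
    using that
  proof (induction n rule: dec_induct)
    case base
    show ?case by (auto simp: u intro!: sum_nonpos mult_nonneg_nonneg sigma_inf_nonneg)
  next
    case (step n)
    have "c * real (Suc n) powr (1 - a) * real (Suc n) powr (a - 2)
        \<le> sigma_inf V (Suc n) * real (Suc n) powr (a - 2)"
      using step by (intro mult_right_mono lo) auto
    moreover have "real (Suc n) powr (1 - a) * real (Suc n) powr (a - 2) = inverse (real (Suc n))"
      by (simp flip: powr_add add: powr_minus)
    ultimately have "sigma_inf V (Suc n) * (u (Suc n) + u (Suc n)) \<le> - c * inverse (real (Suc n))"
      unfolding u by (simp add: mult.assoc del: of_nat_Suc)
    with step.IH show ?case by (simp add: harm_Suc algebra_simps)
  qed
  have "filterlim (\<lambda>n. - c * harm n + c * harm N) at_bot sequentially"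
  proof -
    have "filterlim (\<lambda>n. c * harm n - c * harm N :: real) at_top sequentially"
      using filterlim_tendsto_add_at_top[OF tendsto_const[of "- (c * harm N)"]
          filterlim_tendsto_pos_mult_at_top[OF tendsto_const c harm_at_top]]
      by (simp add: algebra_simps)
    then show ?thesis by (simp add: filterlim_uminus_at_top algebra_simps)
  qed
  then have "filterlim ?P at_bot sequentially"
    by (rule filterlim_at_bot_mono) (use le in \<open>auto simp: eventually_sequentially\<close>)
  then show ?thesis
    by (simp add: linear_term_eq_MInf_iff tendsto_MInfty filterlim_at_bot_dense)
qed

section \<open>Square-summability of the witness and conclusion\<close>

lemma powr_in_ell2:
  assumes "p < - 1/2"
  shows "(\<lambda>i. c * real i powr p) \<in> ell2"
proof -
  have "summable (\<lambda>i. c\<^sup>2 * real i powr (2 * p))"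
    using assms by (intro summable_mult) (simp add: summable_real_powr_iff)
  moreover have "(c * real i powr p)\<^sup>2 = c\<^sup>2 * real i powr (2 * p)" for i
    by (simp add: power_mult_distrib power2_eq_square flip: powr_add)
  ultimately have "summable (\<lambda>i. norm ((c * real i powr p)\<^sup>2))" by simp
  then have "(\<lambda>i. (c * real i powr p)\<^sup>2) summable_on {1..}"
    by (intro summable_on_subset_banach[OF norm_summable_imp_summable_on]) auto
  then show ?thesis unfolding ell2_def by simp
qed

theorem mainTheorem4:
  fixes a :: real and V :: "real \<Rightarrow> ereal"
  assumes "1 < a" and "a < 3 / 2" and "potential a V"
  shows "\<not> (\<exists>m::real. \<forall>p\<in>Dom_E1. ereal m \<le> E1 V p) \<and> (\<exists>p\<in>Dom_E1. E1 V p = - \<infinity>)"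
proof -
  \<comment> \<open>The exponent satisfies a - 2 < -1/2 because a < 3/2. It is also negative, so
    i^(a-2) \<le> 1 for i \<ge> 1, and the factor 1/2 then gives u i \<ge> -1/2.\<close>
  define u where "u = (\<lambda>i::nat. - (real i powr (a - 2) / 2))"
  have ell2: "u \<in> ell2"
    using powr_in_ell2[of "a - 2" "- 1/2"] assms by (simp add: u_def)
  have u: "u i \<ge> - 1/2" if "i \<ge> 1" for i
    using powr_mono[of "a - 2" 0 "real i"] that assms by (simp add: u_def)
  have dom: "(u, u) \<in> Dom_E1"
    using ell2 u by (force simp: Dom_E1_def)
  have I: "0 \<le> interaction V u" "interaction V u < \<infinity>"
    using interaction_finite[OF assms(3,1) ell2 u] by auto
  have "linear_term V u u = - \<infinity>"
    unfolding u_def using assms by (intro linear_term_diverges)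
  with I have "E1 V (u, u) = - \<infinity>"
    by (subst E1_eq_MInf_iff) auto
  \<comment> \<open>The value -\<infinity> lies below every real m, so the same pair refutes
    boundedness from below.\<close>
  with dom show ?thesis by force
qed

end
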